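(* Let $\mathbb{F}$ be an arbitrary field and let $p\in\mathbb{F}[x]$ be a monic irreducible polynomial with $\deg(p)=s$, with companion matrix $C\in M_s(\mathbb{F})$. Let $G=\mathrm{diag}(G_1,\ldots,G_m)$ be a generalized Jordan matrix with characteristic polynomial $p_G=p^r$ and generalized Segre characteristic $\alpha=(\alpha_1,\ldots,\alpha_m)$, and let $\tau=(\tau_1,\ldots,\tau_{\alpha_1})$ be the conjugate partition of $\alpha$. Then $G$ is similar to the matrix $$W=\begin{bmatrix} W_1&E_2&\ldots&0&0\\ 0&W_2&\ddots&0&0\\ \vdots&\vdots&\ddots&\ddots&\vdots\\ 0&0&\ldots&W_{\alpha_1-1}&E_{\alpha_1}\\ 0&0&\ldots&0&W_{\alpha_1} \end{bmatrix},$$ where $W_i=\mathrm{diag}(C,\ldots,C)\in M_{s\tau_i}(\mathbb{F})$ for $i=1,\ldots,\alpha_1$, and, for $i=1,\ldots,\alpha_1-1$, $$E_{i+1}=\begin{bmatrix}\mathrm{diag}(E,\ldots,E)\\ 0\end{bmatrix}\in M_{s\tau_i\times s\tau_{i+1}}(\mathbb{F}),$$ with $\tau_{i+1}$ copies of $E$ in the block $\mathrm{diag}(E,\ldots,E)\in M_{s\tau_{i+1}}(\mathbb{F})$.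
   Context: Let $p=x^s+c_{s-1}x^{s-1}+\cdots+c_1x+c_0\in\mathbb{F}[x]$. Its companion matrix $C\in M_s(\mathbb{F})$ has ones on the first subdiagonal, last column $(-c_0,-c_1,\ldots,-c_{s-1})^T$, and zeros elsewhere. $E\in M_s(\mathbb{F})$ is the matrix whose only nonzero entry is a $1$ in position $(1,s)$. A generalized Jordan block $G_i\in M_{s\alpha_i}(\mathbb{F})$ is the $\alpha_i\times\alpha_i$ block matrix with $s\times s$ blocks having $C$ in every diagonal block, $E$ in every block of the first block subdiagonal, and $0$ elsewhere. A generalized Jordan matrix is $G=\mathrm{diag}(G_1,\ldots,G_m)$, all $G_i$ built from the same $p$, with $\alpha_1\ge\alpha_2\ge\cdots\ge\alpha_m\ge0$ and $\sum_i\alpha_i=r$; $\alpha=(\alpha_1,\ldots,\alpha_m)$ is its generalized Segre characteristic. The conjugate partition is given by $\tau_i=\#\{j:\alpha_j\ge i\}$, $i=1,\ldots,\alpha_1$. *)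

theory Defs
  imports "Jordan_Normal_Form.Char_Poly"
begin

text \<open>Matrices are 0-indexed, whereas the entries of a partition and of its conjugate are
  referred to by the usual indices starting at 1.\<close>

definition companion_mat :: "'a::comm_ring_1 poly \<Rightarrow> 'a mat" where
  "companion_mat p = (let s = degree p in mat s s (\<lambda>(i, j).
     if j = s - 1 then - coeff p i else if i = j + 1 then 1 else 0))"

definition corner_mat :: "nat \<Rightarrow> 'a::{zero,one} mat" where
  "corner_mat s = mat s s (\<lambda>(i, j). if i = 0 \<and> j = s - 1 then 1 else 0)"

text \<open>If consecutive blocks have the sizes listed in \<open>ns\<close>, then \<open>block_pos ns k\<close> is the pair of
  the number of the block containing the index \<open>k\<close> and the offset of \<open>k\<close> in that block, both
  counted from 0. Blocks may be empty. The clause for the empty list is never used on indices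
  \<open>k < sum_list ns\<close>.\<close>

fun block_pos :: "nat list \<Rightarrow> nat \<Rightarrow> nat \<times> nat" where
  "block_pos [] k = (0, k)"
| "block_pos (n # ns) k =
     (if k < n then (0, k) else (let (i, a) = block_pos ns (k - n) in (Suc i, a)))"

text \<open>The block matrix with row heights \<open>rs\<close> and column widths \<open>cs\<close> whose block in block row \<open>i\<close>
  and block column \<open>j\<close> is \<open>B i j\<close>, which should have dimensions \<open>rs ! i\<close> and \<open>cs ! j\<close>.\<close>

definition block_mat :: "nat list \<Rightarrow> nat list \<Rightarrow> (nat \<Rightarrow> nat \<Rightarrow> 'a mat) \<Rightarrow> 'a mat" where
  "block_mat rs cs B = mat (sum_list rs) (sum_list cs) (\<lambda>(k, l).
     let (i, a) = block_pos rs k; (j, b) = block_pos cs l in B i j $$ (a, b))"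

lemma block_pos_sum_list:
  assumes "i < length ns" "a < ns ! i"
  shows "block_pos ns (sum_list (take i ns) + a) = (i, a)"
  using assms
proof (induction ns arbitrary: i)
  case (Cons n ns)
  then show ?case by (cases i) auto
qed simp

lemma block_index_less:
  assumes "i < length ns" "a < ns ! i"
  shows "sum_list (take i ns) + a < sum_list (ns :: nat list)"
  using assms
proof (induction ns arbitrary: i)
  case (Cons n ns)
  then show ?case by (cases i) auto
qed simp

lemma block_mat_index:
  assumes "i < length rs" "a < rs ! i" "j < length cs" "b < cs ! j"
  shows "block_mat rs cs B $$ (sum_list (take i rs) + a, sum_list (take j cs) + b)
    = B i j $$ (a, b)"
  using assms by (simp add: block_mat_def block_pos_sum_list block_index_less)

definition gen_jordan_block :: "'a::field poly \<Rightarrow> nat \<Rightarrow> 'a mat" where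
  "gen_jordan_block p n = (let s = degree p in
     block_mat (replicate n s) (replicate n s) (\<lambda>i j.
       if i = j then companion_mat p
       else if i = j + 1 then corner_mat s
       else 0\<^sub>m s s))"

definition gen_jordan_mat :: "'a::field poly \<Rightarrow> nat list \<Rightarrow> 'a mat" where
  "gen_jordan_mat p \<alpha> = diag_block_mat (map (gen_jordan_block p) \<alpha>)"

definition conj_part :: "nat list \<Rightarrow> nat \<Rightarrow> nat" where
  "conj_part \<alpha> i = card {j. j < length \<alpha> \<and> \<alpha> ! j \<ge> i}"

text \<open>\<open>weyr_diag p \<alpha> i\<close> is $W_i$ and \<open>weyr_super p \<alpha> i\<close> is $E_{i+1}$, for $i \ge 1$.\<close>

definition weyr_diag :: "'a::field poly \<Rightarrow> nat list \<Rightarrow> nat \<Rightarrow> 'a mat" where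
  "weyr_diag p \<alpha> i = diag_block_mat (replicate (conj_part \<alpha> i) (companion_mat p))"

definition weyr_super :: "'a::field poly \<Rightarrow> nat list \<Rightarrow> nat \<Rightarrow> 'a mat" where
  "weyr_super p \<alpha> i = (let s = degree p in
     diag_block_mat (replicate (conj_part \<alpha> (i + 1)) (corner_mat s))
     @\<^sub>r 0\<^sub>m (s * (conj_part \<alpha> i - conj_part \<alpha> (i + 1))) (s * conj_part \<alpha> (i + 1)))"

text \<open>The number of block rows is the largest part \<open>hd \<alpha>\<close>, for nonempty \<open>\<alpha>\<close> sorted in
  decreasing order. The shifts \<open>i + 1\<close>, \<open>j + 1\<close> convert 0-based block numbers.\<close>

definition weyr_mat :: "'a::field poly \<Rightarrow> nat list \<Rightarrow> 'a mat" where
  "weyr_mat p \<alpha> = (let s = degree p; ns = map (\<lambda>i. s * conj_part \<alpha> i) [1..<hd \<alpha> + 1] in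
     block_mat ns ns (\<lambda>i j.
       if i = j then weyr_diag p \<alpha> (i + 1)
       else if j = i + 1 then weyr_super p \<alpha> (i + 1)
       else 0\<^sub>m (s * conj_part \<alpha> (i + 1)) (s * conj_part \<alpha> (j + 1))))"

end

theory Submission
  imports Defs
begin

text \<open>The two matrices differ only in the order of the basis vectors. The basis of \<open>G\<close> consists
  of chains of blocks: in the chain with number \<open>j\<close> the blocks sit at positions \<open>k < \<alpha> ! j\<close>, every
  block carries \<open>C\<close>, and \<open>E\<close> occurs in block row \<open>k + 1\<close> and block column \<open>k\<close>. In \<open>W\<close> the blocks
  are grouped by levels \<open>i\<close>; the level \<open>i\<close> has one block \<open>j\<close> for every chain with
  \<open>i < \<alpha> ! j\<close>. These are the blocks with \<open>j\<close> less than the conjugate part of that level, since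
  \<open>\<alpha>\<close> is decreasing (\<open>less_conj_part_iff\<close>). Again \<open>C\<close> is on the diagonal, but \<open>E\<close> connects block row
  \<open>(i, j)\<close> with block column \<open>(i + 1, j)\<close>, above the diagonal. So every chain has to be run
  through backwards: block \<open>k\<close> of chain \<open>j\<close> corresponds to block \<open>j\<close> of level
  \<open>\<alpha> ! j - 1 - k\<close>, and the offset \<open>a\<close> inside the block is kept.

  To make this precise, the indices of both matrices are labelled by triples of block numbers and
  an offset. The labellings are bijections (\<open>bij_betw_block_index\<close>), the entries are given in
  terms of the labels by \<open>gen_jordan_mat_index\<close> and \<open>weyr_mat_index\<close>, and matrices whose
  entries agree up to a relabelling are similar through a permutation matrix
  (\<open>similar_mat_relabel\<close>).\<close>

section \<open>Similarity by relabelling the basis\<close>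

text \<open>Labelling the indices of both matrices by one set \<open>L\<close> induces a permutation \<open>\<phi>\<close> of the
  indices that carries \<open>A\<close> to \<open>B\<close>; conjugation by its permutation matrix realizes \<open>\<phi>\<close>. The
  sizes \<open>n\<close> and \<open>m\<close> are distinct variables because for the matrices in question, whose sizes
  are computed from a partition and from its conjugate, their equality is most easily
  seen by comparing them with the cardinality of \<open>L\<close>.\<close>

lemma similar_mat_relabel:
  fixes A B :: "'a::field mat"
  assumes A: "A \<in> carrier_mat n n" and B: "B \<in> carrier_mat m m"
    and g: "bij_betw g L {..<n}" and w: "bij_betw w L {..<m}"
    and AB: "\<And>x y. x \<in> L \<Longrightarrow> y \<in> L \<Longrightarrow> A $$ (g x, g y) = B $$ (w x, w y)"
  shows "similar_mat A B"
proof -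
  have "m = n"
    using bij_betw_same_card[OF g] bij_betw_same_card[OF w] by simp
  define \<phi> where "\<phi> = w \<circ> inv_into L g"
  have \<phi>: "bij_betw \<phi> {..<n} {..<n}"
    unfolding \<phi>_def using bij_betw_trans[OF bij_betw_inv_into[OF g] w] \<open>m = n\<close> by simp
  then have less: "\<phi> i < n" if "i < n" for i
    using that bij_betwE by blast
  have inj: "\<phi> i = \<phi> j \<longleftrightarrow> i = j" if "i < n" "j < n" for i j
    using \<phi> that by (auto simp: bij_betw_def inj_on_def)
  have entry: "A $$ (i, j) = B $$ (\<phi> i, \<phi> j)" if "i < n" "j < n" for i j
  proof -
    let ?x = "inv_into L g i" and ?y = "inv_into L g j"
    have "g ?x = i" "g ?y = j" "?x \<in> L" "?y \<in> L"
      using g that by (auto simp: bij_betw_def f_inv_into_f inv_into_into)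
    then show ?thesis using AB[of ?x ?y] by (simp add: \<phi>_def)
  qed
  \<comment> \<open>Left multiplication by \<open>P\<close> applies \<open>\<phi>\<close> to the row index, right multiplication by its transpose
    \<open>Q\<close> applies \<open>\<phi>\<close> to the column index.\<close>
  define P where "P = mat n n (\<lambda>(i, j). if \<phi> i = j then 1 else (0::'a))"
  define Q where "Q = mat n n (\<lambda>(i, j). if i = \<phi> j then 1 else (0::'a))"
  have P: "P \<in> carrier_mat n n" and Q: "Q \<in> carrier_mat n n"
    by (simp_all add: P_def Q_def)
  have PM: "(P * M) $$ (i, j) = M $$ (\<phi> i, j)"
    if "M \<in> carrier_mat n n" "i < n" "j < n" for M i j
  proof -
    have "(P * M) $$ (i, j) = (\<Sum>k\<in>{0..<n}. P $$ (i, k) * M $$ (k, j))"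
      using that P by (simp add: scalar_prod_def)
    also have "\<dots> = (\<Sum>k\<in>{0..<n}. if \<phi> i = k then M $$ (k, j) else 0)"
      by (rule sum.cong) (use that in \<open>auto simp: P_def\<close>)
    also have "\<dots> = M $$ (\<phi> i, j)"
      using less that by simp
    finally show ?thesis .
  qed
  have MQ: "(M * Q) $$ (i, j) = M $$ (i, \<phi> j)"
    if "M \<in> carrier_mat n n" "i < n" "j < n" for M i j
  proof -
    have "(M * Q) $$ (i, j) = (\<Sum>k\<in>{0..<n}. M $$ (i, k) * Q $$ (k, j))"
      using that Q by (simp add: scalar_prod_def)
    also have "\<dots> = (\<Sum>k\<in>{0..<n}. if k = \<phi> j then M $$ (i, k) else 0)"
      by (rule sum.cong) (use that in \<open>auto simp: Q_def\<close>)
    also have "\<dots> = M $$ (i, \<phi> j)"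
      using less that by simp
    finally show ?thesis .
  qed
  have B': "B \<in> carrier_mat n n" using B \<open>m = n\<close> by simp
  have PQ: "P * Q = 1\<^sub>m n"
  proof (rule eq_matI)
    fix i j assume "i < dim_row (1\<^sub>m n :: 'a mat)" "j < dim_col (1\<^sub>m n :: 'a mat)"
    then have ij: "i < n" "j < n" by simp_all
    show "(P * Q) $$ (i, j) = 1\<^sub>m n $$ (i, j)"
      using less inj ij by (subst PM[OF Q ij]) (simp add: Q_def)
  qed (use P Q in simp_all)
  have QP: "Q * P = 1\<^sub>m n"
    by (rule mat_mult_left_right_inverse[OF P Q PQ])
  have "A = P * B * Q"
    by (rule eq_matI) (use A P Q B' in \<open>auto simp del: index_mult_mat(1) simp: MQ PM less entry\<close>)
  then show ?thesis
    by (intro similar_matI[of A B P Q n]) (use A B' P Q PQ QP in simp_all)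
qed

section \<open>Indices of block matrices\<close>

text \<open>The inverse of \<open>block_pos\<close>, in curried form.\<close>

definition block_index :: "nat list \<Rightarrow> nat \<Rightarrow> nat \<Rightarrow> nat" where
  "block_index ns i a = sum_list (take i ns) + a"

lemma block_index_replicate: "i < n \<Longrightarrow> block_index (replicate n s) i a = i * s + a"
  by (simp add: block_index_def sum_list_replicate)

text \<open>The family \<open>h\<close> labels the offsets inside the blocks in their turn, so that the indices of
  nested block matrices, which is what both normal forms are, can be labelled in one step.\<close>

lemma bij_betw_block_index:
  assumes "\<And>i. i < length ns \<Longrightarrow> bij_betw (h i) (S i) {..<ns ! i}"
  shows "bij_betw (\<lambda>(i, x). block_index ns i (h i x)) (Sigma {..<length ns} S) {..<sum_list ns}"
proof -
  have into: "h i x < ns ! i" if "i < length ns" "x \<in> S i" for i x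
    using assms[OF that(1)] that(2) by (auto simp: bij_betw_def)
  have pos: "block_pos ns (block_index ns i (h i x)) = (i, h i x)" if "i < length ns" "x \<in> S i" for i x
    unfolding block_index_def using block_pos_sum_list into that by blast
  have inj: "inj_on (\<lambda>(i, x). block_index ns i (h i x)) (Sigma {..<length ns} S)"
  proof (rule inj_onI, clarsimp)
    fix i x j y
    assume *: "i < length ns" "x \<in> S i" "j < length ns" "y \<in> S j"
      and eq: "block_index ns i (h i x) = block_index ns j (h j y)"
    have "(i, h i x) = (j, h j y)"
      using pos[of i x] pos[of j y] * eq by metis
    then have "i = j" "h i x = h i y" by auto
    moreover have "inj_on (h i) (S i)" using assms[of i] * by (auto simp: bij_betw_def)
    ultimately show "i = j \<and> x = y"
      using * by (auto dest: inj_onD)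
  qed
  have sub: "(\<lambda>(i, x). block_index ns i (h i x)) ` Sigma {..<length ns} S \<subseteq> {..<sum_list ns}"
    using into block_index_less by (auto simp: block_index_def)
  have cardS: "card (S i) = ns ! i" "finite (S i)" if "i < length ns" for i
    using bij_betw_same_card[OF assms[OF that]] bij_betw_finite[OF assms[OF that]] by auto
  \<comment> \<open>An injection between finite sets of the same cardinality is onto.\<close>
  have "card (Sigma {..<length ns} S) = sum_list ns"
    by (subst card_SigmaI) (auto simp: cardS sum_list_sum_nth atLeast0LessThan)
  then have "(\<lambda>(i, x). block_index ns i (h i x)) ` Sigma {..<length ns} S = {..<sum_list ns}"
    using card_subset_eq[OF _ sub] card_image[OF inj] by simp
  with inj show ?thesis by (simp add: bij_betw_def)
qed

lemma bij_betw_block_index_replicate: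
  fixes n s :: nat
  shows "bij_betw (\<lambda>(i, a). i * s + a) ({..<n} \<times> {..<s}) {..<n * s}"
proof -
  have "bij_betw (\<lambda>(i, a). block_index (replicate n s) i a) ({..<n} \<times> {..<s}) {..<n * s}"
    using bij_betw_block_index[of "replicate n s" "\<lambda>_ a. a" "\<lambda>_. {..<s}"]
    by (simp add: sum_list_replicate bij_betw_def)
  then show ?thesis
    by (rule iffD1[OF bij_betw_cong, rotated]) (auto simp: block_index_replicate)
qed

lemma diag_block_mat_block_index:
  assumes "i < length As" "a < dim_row (As ! i)" "j < length As" "b < dim_col (As ! j)"
  shows "diag_block_mat As $$ (block_index (map dim_row As) i a, block_index (map dim_col As) j b)
    = (if i = j then As ! i $$ (a, b) else 0)"
  using assms
proof (induction As arbitrary: i j)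
  case (Cons A As)
  have dims: "dim_row (diag_block_mat As) = sum_list (map dim_row As)"
    "dim_col (diag_block_mat As) = sum_list (map dim_col As)"
    by (simp_all add: dim_diag_block_mat)
  have r: "block_index (map dim_row As) i' a < sum_list (map dim_row As)"
    if "i = Suc i'" for i'
    using block_index_less[of i' "map dim_row As" a] Cons.prems that by (simp add: block_index_def)
  have c: "block_index (map dim_col As) j' b < sum_list (map dim_col As)"
    if "j = Suc j'" for j'
    using block_index_less[of j' "map dim_col As" b] Cons.prems that by (simp add: block_index_def)
  show ?case
    using Cons.prems Cons.IH r c
    by (cases i; cases j) (auto simp: Let_def dims block_index_def add.assoc)
qed simp

lemma diag_block_mat_replicate_index:
  assumes "A \<in> carrier_mat s s" "i < n" "j < n" "a < s" "b < s"
  shows "diag_block_mat (replicate n A) $$ (i * s + a, j * s + b)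
    = (if i = j then A $$ (a, b) else 0)"
  using diag_block_mat_block_index[of i "replicate n A" a j b] assms
  by (simp add: block_index_replicate)

lemma dim_diag_block_mat_replicate:
  assumes "A \<in> carrier_mat s s"
  shows "dim_row (diag_block_mat (replicate n A)) = n * s"
    "dim_col (diag_block_mat (replicate n A)) = n * s"
  using assms by (simp_all add: dim_diag_block_mat sum_list_replicate)

lemma index_less_mult: "i < n \<Longrightarrow> a < s \<Longrightarrow> i * s + a < n * (s::nat)"
  using bij_betw_block_index_replicate[of s n] by (force simp: bij_betw_def)

section \<open>Entries of the generalized Jordan matrix\<close>

lemma companion_mat_carrier: "companion_mat p \<in> carrier_mat (degree p) (degree p)"
  by (simp add: companion_mat_def Let_def)

lemma corner_mat_carrier: "corner_mat s \<in> carrier_mat s s"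
  by (simp add: corner_mat_def)

lemma gen_jordan_block_carrier:
  "gen_jordan_block p n \<in> carrier_mat (n * degree p) (n * degree p)"
  by (simp add: gen_jordan_block_def block_mat_def Let_def sum_list_replicate)

lemma gen_jordan_block_index:
  fixes p :: "'a::field poly"
  assumes "k < n" "k' < n" "a < degree p" "a' < degree p"
  shows "gen_jordan_block p n $$ (k * degree p + a, k' * degree p + a') =
    (if k = k' then companion_mat p $$ (a, a')
     else if k = k' + 1 then corner_mat (degree p) $$ (a, a') else 0)"
proof -
  let ?ns = "replicate n (degree p)"
  have "block_mat ?ns ?ns B $$ (k * degree p + a, k' * degree p + a') = B k k' $$ (a, a')"
    for B :: "nat \<Rightarrow> nat \<Rightarrow> 'a mat"
    using block_mat_index[of k ?ns a k' ?ns a' B] assms by (simp add: sum_list_replicate)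
  then show ?thesis
    unfolding gen_jordan_block_def Let_def using assms by simp
qed

lemma gen_jordan_mat_index:
  assumes "j < length \<alpha>" "j' < length \<alpha>" "k < \<alpha> ! j" "k' < \<alpha> ! j'"
    "a < degree p" "a' < degree p"
  defines "ns \<equiv> map (\<lambda>n. n * degree p) \<alpha>"
  shows "gen_jordan_mat p \<alpha> $$
      (block_index ns j (k * degree p + a), block_index ns j' (k' * degree p + a')) =
    (if j = j' then
       if k = k' then companion_mat p $$ (a, a')
       else if k = k' + 1 then corner_mat (degree p) $$ (a, a') else 0
     else 0)"
proof -
  have dims: "map dim_row (map (gen_jordan_block p) \<alpha>) = ns"
    "map dim_col (map (gen_jordan_block p) \<alpha>) = ns"
    using gen_jordan_block_carrier[of p] by (auto simp: ns_def)
  have "k * degree p + a < \<alpha> ! j * degree p" "k' * degree p + a' < \<alpha> ! j' * degree p"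
    using assms by (simp_all add: index_less_mult)
  then have "gen_jordan_mat p \<alpha> $$
      (block_index ns j (k * degree p + a), block_index ns j' (k' * degree p + a')) =
    (if j = j' then
       gen_jordan_block p (\<alpha> ! j) $$ (k * degree p + a, k' * degree p + a') else 0)"
    unfolding gen_jordan_mat_def
    by (subst diag_block_mat_block_index[of j "map (gen_jordan_block p) \<alpha>" _ j', unfolded dims])
      (use assms(1,2) carrier_matD[OF gen_jordan_block_carrier[of p]] in auto)
  also have "\<dots> = (if j = j' then
       if k = k' then companion_mat p $$ (a, a')
       else if k = k' + 1 then corner_mat (degree p) $$ (a, a') else 0
     else 0)"
    using assms(3-6) by (cases "j = j'") (simp_all only: gen_jordan_block_index if_True if_False)
  finally show ?thesis .
qed

lemma gen_jordan_mat_carrier: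
  "gen_jordan_mat p \<alpha> \<in> carrier_mat
    (sum_list (map (\<lambda>n. n * degree p) \<alpha>)) (sum_list (map (\<lambda>n. n * degree p) \<alpha>))"
proof -
  have "map dim_row (map (gen_jordan_block p) \<alpha>) = map (\<lambda>n. n * degree p) \<alpha>"
    "map dim_col (map (gen_jordan_block p) \<alpha>) = map (\<lambda>n. n * degree p) \<alpha>"
    using gen_jordan_block_carrier[of p] by auto
  then show ?thesis
    unfolding gen_jordan_mat_def by (intro carrier_matI) (simp_all only: dim_diag_block_mat)
qed

section \<open>Entries of the Weyr matrix\<close>

text \<open>As \<open>\<alpha>\<close> is decreasing, the set counted by the conjugate part is an initial segment, so it is
  determined by its cardinality. Hence the blocks of \<open>weyr_diag p \<alpha> i\<close> belong to the first
  \<open>conj_part \<alpha> i\<close> chains, each to the chain with the same number.\<close>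

lemma less_conj_part_iff:
  assumes "sorted_wrt (\<ge>) \<alpha>"
  shows "j < conj_part \<alpha> i \<longleftrightarrow> j < length \<alpha> \<and> i \<le> \<alpha> ! j"
proof -
  let ?S = "{j. j < length \<alpha> \<and> i \<le> \<alpha> ! j}"
  have down: "k \<in> ?S" if "j \<in> ?S" "k \<le> j" for j k
    using that sorted_wrt_nth_less[OF assms, of k j] by (cases "k = j") auto
  have fin: "finite ?S" by simp
  have "?S = {..<card ?S}"
  proof -
    obtain m where "?S = {..<m}"
    proof (cases "?S = {}")
      case False
      then have "?S = {..<Suc (Max ?S)}"
        using Max_in[OF fin False] Max_ge[OF fin] down
        unfolding set_eq_iff lessThan_iff less_Suc_eq_le by blast
      then show ?thesis using that by blast
    qed (use that[of 0] in simp)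
    then show ?thesis by simp
  qed
  then show ?thesis by (auto simp: conj_part_def)
qed

text \<open>The block sizes of \<open>weyr_mat\<close>, listed so that list positions and levels are both counted
  from 0, and with the factors in the order in which \<open>block_index\<close> of equal blocks produces
  them.\<close>

definition weyr_heights :: "'a::field poly \<Rightarrow> nat list \<Rightarrow> nat list" where
  "weyr_heights p \<alpha> = map (\<lambda>i. conj_part \<alpha> (i + 1) * degree p) [0..<hd \<alpha>]"

lemma weyr_heights_eq:
  "weyr_heights p \<alpha> = map (\<lambda>i. degree p * conj_part \<alpha> i) [1..<hd \<alpha> + 1]"
  by (rule nth_equalityI) (auto simp: weyr_heights_def nth_append simp del: upt_Suc)

lemma weyr_mat_carrier:
  "weyr_mat p \<alpha> \<in> carrier_mat (sum_list (weyr_heights p \<alpha>)) (sum_list (weyr_heights p \<alpha>))"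
  by (simp add: weyr_mat_def block_mat_def Let_def weyr_heights_eq del: upt_Suc)

lemma weyr_diag_index:
  assumes "j < conj_part \<alpha> i" "j' < conj_part \<alpha> i" "a < degree p" "a' < degree p"
  shows "weyr_diag p \<alpha> i $$ (j * degree p + a, j' * degree p + a') =
    (if j = j' then companion_mat p $$ (a, a') else 0)"
  using assms by (simp add: weyr_diag_def diag_block_mat_replicate_index[OF companion_mat_carrier])

lemma conj_part_antimono: "i \<le> i' \<Longrightarrow> conj_part \<alpha> i' \<le> conj_part \<alpha> i"
  unfolding conj_part_def by (rule card_mono) auto

text \<open>The zero rows below the diagonal part are those with \<open>j \<ge> conj_part \<alpha> (i + 1) > j'\<close>, so the
  case \<open>j \<noteq> j'\<close> covers them.\<close>

lemma weyr_super_index: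
  assumes "j < conj_part \<alpha> i" "j' < conj_part \<alpha> (i + 1)" "a < degree p" "a' < degree p"
  shows "weyr_super p \<alpha> i $$ (j * degree p + a, j' * degree p + a') =
    (if j = j' then corner_mat (degree p) $$ (a, a') else 0)"
proof -
  let ?s = "degree p" and ?t = "conj_part \<alpha> (i + 1)"
  note dims = dim_diag_block_mat_replicate[OF corner_mat_carrier]
  have le: "?t \<le> conj_part \<alpha> i" by (rule conj_part_antimono) simp
  have total: "?t * ?s + ?s * (conj_part \<alpha> i - ?t) = conj_part \<alpha> i * ?s"
    using le by (simp add: diff_mult_distrib2 mult.commute)
  have row: "j * ?s + a < conj_part \<alpha> i * ?s" and col: "j' * ?s + a' < ?t * ?s"
    using assms by (simp_all only: index_less_mult)
  show ?thesis
  proof (cases "j < ?t")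
    case True
    then have "j * ?s + a < ?t * ?s" using assms by (simp only: index_less_mult)
    with True row col total assms show ?thesis
      by (simp add: weyr_super_def append_rows_def Let_def dims
          diag_block_mat_replicate_index[OF corner_mat_carrier])
  next
    case False
    then have "\<not> j * ?s + a < ?t * ?s"
      by (metis mult_le_mono1 not_less trans_le_add1)
    with False row col total assms show ?thesis
      by (auto simp: weyr_super_def append_rows_def Let_def dims mult.commute)
  qed
qed

lemma weyr_mat_index:
  assumes "i < hd \<alpha>" "i' < hd \<alpha>" "j < conj_part \<alpha> (i + 1)" "j' < conj_part \<alpha> (i' + 1)"
    "a < degree p" "a' < degree p"
  shows "weyr_mat p \<alpha> $$
      (block_index (weyr_heights p \<alpha>) i (j * degree p + a),
       block_index (weyr_heights p \<alpha>) i' (j' * degree p + a')) =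
    (if j = j' then
       if i = i' then companion_mat p $$ (a, a')
       else if i' = i + 1 then corner_mat (degree p) $$ (a, a') else 0
     else 0)"
proof -
  have "j * degree p + a < conj_part \<alpha> (i + 1) * degree p"
    "j' * degree p + a' < conj_part \<alpha> (i' + 1) * degree p"
    using assms by (simp_all only: index_less_mult)
  then show ?thesis
    unfolding weyr_mat_def Let_def weyr_heights_eq[symmetric] block_index_def
    using assms weyr_diag_index[of j \<alpha> "i + 1" j'] weyr_super_index[of j \<alpha> "i + 1" j' a p a']
    by (subst block_mat_index) (auto simp: weyr_heights_def mult.commute)
qed

section \<open>Similarity of the two normal forms\<close>

theorem theorem3p1:
  fixes p :: "'a::field poly" and \<alpha> :: "nat list" and r :: nat
  assumes "monic p" and "irreducible p"
    and "\<alpha> \<noteq> []" and "sorted_wrt (\<ge>) \<alpha>" and "sum_list \<alpha> = r"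
    and "char_poly (gen_jordan_mat p \<alpha>) = p ^ r"
  shows "similar_mat (gen_jordan_mat p \<alpha>) (weyr_mat p \<alpha>)"
proof -
  let ?s = "degree p"
  let ?ns = "map (\<lambda>n. n * ?s) \<alpha>"
  let ?ws = "weyr_heights p \<alpha>"
  note tau = less_conj_part_iff[OF assms(4)]
  have hd: "\<alpha> ! j \<le> hd \<alpha>" if "j < length \<alpha>" for j
    using that assms(3) sorted_wrt_nth_less[OF assms(4), of 0 j]
    by (cases "j = 0") (auto simp: hd_conv_nth)
  \<comment> \<open>\<open>J\<close> consists of triples (chain, position, offset) and \<open>V\<close> of triples (level, chain, offset).
    The map \<open>\<phi>\<close> runs through each chain backwards, which turns the subdiagonal \<open>E\<close> into
    superdiagonal ones.\<close>
  define J where "J = (SIGMA j:{..<length \<alpha>}. {..<\<alpha> ! j} \<times> {..<?s})"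
  define V where "V = (SIGMA i:{..<hd \<alpha>}. {..<conj_part \<alpha> (i + 1)} \<times> {..<?s})"
  define g where "g = (\<lambda>(j, k, a). block_index ?ns j (k * ?s + a))"
  define w where "w = (\<lambda>(i, j, a). block_index ?ws i (j * ?s + a))"
  define \<phi> where "\<phi> = (\<lambda>(j, k, a :: nat). (\<alpha> ! j - 1 - k, j, a))"
  have "bij_betw (\<lambda>(j, x). block_index ?ns j ((\<lambda>(k, a). k * ?s + a) x))
      (SIGMA j:{..<length ?ns}. {..<\<alpha> ! j} \<times> {..<?s}) {..<sum_list ?ns}"
    by (rule bij_betw_block_index) (simp add: bij_betw_block_index_replicate)
  then have g: "bij_betw g J {..<sum_list ?ns}"
    by (simp add: g_def J_def case_prod_unfold)
  have "bij_betw (\<lambda>(i, x). block_index ?ws i ((\<lambda>(j, a). j * ?s + a) x))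
      (SIGMA i:{..<length ?ws}. {..<conj_part \<alpha> (i + 1)} \<times> {..<?s}) {..<sum_list ?ws}"
    by (rule bij_betw_block_index) (simp add: weyr_heights_def bij_betw_block_index_replicate)
  then have w: "bij_betw w V {..<sum_list ?ws}"
    by (simp add: w_def V_def case_prod_unfold weyr_heights_def)
  have \<phi>: "bij_betw \<phi> J V"
    by (rule bij_betw_byWitness[where f' = "\<lambda>(i, j, a). (j, \<alpha> ! j - 1 - i, a)"])
      (use hd in \<open>fastforce simp: \<phi>_def J_def V_def tau\<close>)+
  show ?thesis
  proof (rule similar_mat_relabel[OF gen_jordan_mat_carrier weyr_mat_carrier g bij_betw_trans[OF \<phi> w]])
    fix x y assume x: "x \<in> J" and y: "y \<in> J"
    obtain j k a j' k' a' where xy: "x = (j, k, a)" "y = (j', k', a')"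
      by (cases x, cases y) auto
    have *: "j < length \<alpha>" "k < \<alpha> ! j" "a < ?s" "j' < length \<alpha>" "k' < \<alpha> ! j'" "a' < ?s"
      using x y by (auto simp: J_def xy)
    have V: "\<phi> x \<in> V" "\<phi> y \<in> V" using \<phi> x y by (auto simp: bij_betw_def)
    show "gen_jordan_mat p \<alpha> $$ (g x, g y) = weyr_mat p \<alpha> $$ ((w \<circ> \<phi>) x, (w \<circ> \<phi>) y)"
      using * V by (auto simp: xy g_def w_def \<phi>_def V_def gen_jordan_mat_index weyr_mat_index)
  qed
qed

end
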